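(* Let $m\geq 1$ be an integer and let $(S,\cdot,\leq)$ be an $m$-simple ordered semigroup. Then every $m$-bi-interior ideal of $S$ is an $m$-bi-ideal of $S$.
   Context: An ordered semigroup $(S,\cdot,\leq)$ is a semigroup with a partial order such that $a\leq b$ implies $xa\leq xb$ and $ax\leq bx$ for all $a,b,x\in S$. For $A,B\subseteq S$, $AB=\{ab: a\in A, b\in B\}$, and $S^m=S\cdots S$ ($m$ factors) is the set of all products of $m$ elements of $S$. For $H\subseteq S$, $(H]=\{t\in S: t\leq h \text{ for some } h\in H\}$. Subsemigroups are understood to be non-empty. - An $m$-left ideal of $S$ is a subsemigroup $L$ of $S$ with $S^mL\subseteq L$ and $(L]=L$; an $m$-right ideal is a subsemigroup $R$ with $RS^m\subseteq R$ and $(R]=R$. - $S$ is $m$-left-simple (respectively $m$-right-simple) if it contains no proper non-trivial $m$-left (respectively $m$-right) ideal, i.e. no (non-empty) $m$-left (respectively $m$-right) ideal other than $S$ itself. $S$ is $m$-simple if it is both $m$-left-simple and $m$-right-simple. - An $m$-bi-ideal is a subsemigroup $B$ of $S$ with $BS^mB\subseteq B$ and $(B]=B$. - An $m$-bi-interior ideal is a non-empty subset $B$ of $S$ (not required to be a subsemigroup) with $(BS^mB]\cap(S^mBS^m]\subseteq B$ and $(B]=B$. *)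

theory Defs
  imports Main "HOL-Library.Set_Algebras"
begin

text \<open>The ordered semigroup \<open>S\<close> is the carrier \<open>UNIV\<close> of a type in the class below.
  For sets, \<open>A * B\<close> is the elementwise product from \<^theory>\<open>HOL-Library.Set_Algebras\<close>.\<close>

class ordered_semigroup = semigroup_mult + order +
  assumes semigroup_mult_left_mono: "a \<le> b \<Longrightarrow> x * a \<le> x * b"
    and semigroup_mult_right_mono: "a \<le> b \<Longrightarrow> a * x \<le> b * x"

text \<open>\<open>A\<^sup>m = A \<cdots> A\<close> with \<open>m\<close> factors. A semigroup has no unit, so \<open>m = 0\<close> is meaningless;
  the value \<open>{}\<close> there is a dummy.\<close>

fun set_pow :: "'a::semigroup_mult set \<Rightarrow> nat \<Rightarrow> 'a set" where
  "set_pow A 0 = {}"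
| "set_pow A (Suc 0) = A"
| "set_pow A (Suc (Suc n)) = A * set_pow A (Suc n)"

definition down_closure :: "'a::order set \<Rightarrow> 'a set" where
  "down_closure H = {t. \<exists>h\<in>H. t \<le> h}"

definition subsemigroup :: "'a::semigroup_mult set \<Rightarrow> bool" where
  "subsemigroup A \<longleftrightarrow> A \<noteq> {} \<and> A * A \<subseteq> A"

definition m_left_ideal :: "nat \<Rightarrow> 'a::ordered_semigroup set \<Rightarrow> bool" where
  "m_left_ideal m L \<longleftrightarrow>
     subsemigroup L \<and> set_pow UNIV m * L \<subseteq> L \<and> down_closure L = L"

definition m_right_ideal :: "nat \<Rightarrow> 'a::ordered_semigroup set \<Rightarrow> bool" where
  "m_right_ideal m R \<longleftrightarrow>
     subsemigroup R \<and> R * set_pow UNIV m \<subseteq> R \<and> down_closure R = R"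

text \<open>Simplicity is a property of the whole semigroup, hence of the type \<open>'a\<close>.\<close>

definition m_left_simple :: "'a::ordered_semigroup itself \<Rightarrow> nat \<Rightarrow> bool" where
  "m_left_simple S m \<longleftrightarrow> (\<forall>L :: 'a set. m_left_ideal m L \<longrightarrow> L = UNIV)"

definition m_right_simple :: "'a::ordered_semigroup itself \<Rightarrow> nat \<Rightarrow> bool" where
  "m_right_simple S m \<longleftrightarrow> (\<forall>R :: 'a set. m_right_ideal m R \<longrightarrow> R = UNIV)"

definition m_simple :: "'a::ordered_semigroup itself \<Rightarrow> nat \<Rightarrow> bool" where
  "m_simple S m \<longleftrightarrow> m_left_simple S m \<and> m_right_simple S m"

definition m_bi_ideal :: "nat \<Rightarrow> 'a::ordered_semigroup set \<Rightarrow> bool" where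
  "m_bi_ideal m B \<longleftrightarrow>
     subsemigroup B \<and> B * set_pow UNIV m * B \<subseteq> B \<and> down_closure B = B"

definition m_bi_interior_ideal :: "nat \<Rightarrow> 'a::ordered_semigroup set \<Rightarrow> bool" where
  "m_bi_interior_ideal m B \<longleftrightarrow>
     B \<noteq> {} \<and>
     down_closure (B * set_pow UNIV m * B) \<inter>
       down_closure (set_pow UNIV m * B * set_pow UNIV m) \<subseteq> B \<and>
     down_closure B = B"

end

theory Submission
  imports Defs
begin

text \<open>In an \<open>m\<close>-simple \<open>S\<close> the one-sided ideals \<open>(S\<^sup>mb]\<close> and \<open>(bS\<^sup>m]\<close> equal \<open>S\<close>, so every \<open>x\<close>
  lies below some \<open>s b\<close> with \<open>s \<in> S\<^sup>m\<close>, and \<open>b\<close> itself lies below some \<open>b t\<close> with \<open>t \<in> S\<^sup>m\<close>.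
  Hence \<open>x \<le> s b t\<close>, that is \<open>(S\<^sup>mBS\<^sup>m] = S\<close>, and the bi-interior condition collapses
  to \<open>(BS\<^sup>mB] \<subseteq> B\<close>. Finally \<open>B\<close> is closed under products, as \<open>a c \<le> a t c \<in> BS\<^sup>mB\<close>.\<close>

text \<open>Makes the principal one-sided ideals below non-empty; \<open>m = 0\<close> must be
  excluded because of the dummy value \<open>{}\<close>.\<close>

lemma set_pow_nonempty:
  fixes A :: "'a::semigroup_mult set"
  assumes "A \<noteq> {}" "m \<ge> 1"
  shows "set_pow A m \<noteq> {}"
  using assms
proof (induction A m rule: set_pow.induct)
  case (3 A n)
  then show ?case
    by (auto simp: set_times_def)
qed auto

text \<open>The first factor ranges over all of S, so it absorbs \<open>y\<close> and the number of
  factors stays \<open>m\<close>.\<close>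

lemma set_pow_UNIV_mult_left:
  fixes x y :: "'a::semigroup_mult"
  assumes "x \<in> set_pow UNIV m"
  shows "y * x \<in> set_pow UNIV m"
\<comment> \<open>\<open>set_pow\<close> splits off its first factor, so a case distinction suffices
  here. On the right the last factor must be reached by induction.\<close>
proof (cases "(UNIV :: 'a set, m)" rule: set_pow.cases)
  case (3 A n)
  then obtain a x' where "x = a * x'" "x' \<in> set_pow UNIV (Suc n)"
    using assms by (auto elim: set_times_elim)
  then have "(y * a) * x' \<in> UNIV * set_pow UNIV (Suc n)"
    by (intro set_times_intro) auto
  then show ?thesis
    using 3 \<open>x = a * x'\<close> by (simp add: mult.assoc)
qed (use assms in auto)

lemma set_pow_UNIV_mult_right:
  fixes x y :: "'a::semigroup_mult"
  assumes "x \<in> set_pow UNIV m"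
  shows "x * y \<in> set_pow UNIV m"
  using assms
proof (induction "UNIV :: 'a set" m arbitrary: x rule: set_pow.induct)
  case (3 n)
  then obtain a x' where "x = a * x'" "x' \<in> set_pow UNIV (Suc n)"
    by (auto elim: set_times_elim)
  then have "a * (x' * y) \<in> UNIV * set_pow UNIV (Suc n)"
    using 3 by (intro set_times_intro) auto
  then show ?case
    using \<open>x = a * x'\<close> by (simp add: mult.assoc)
qed auto

lemma down_closure_idem: "down_closure (down_closure H) = down_closure H"
  by (auto simp: down_closure_def intro: order_trans)

lemma down_closure_increasing: "H \<subseteq> down_closure H"
  by (auto simp: down_closure_def)

text \<open>The set absorbs arbitrary left factors, not just those from S^m. This one fact gives
  both closure under products and the ideal property.\<close>

lemma m_left_ideal_principal:
  fixes b :: "'a::ordered_semigroup"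
  assumes "m \<ge> 1"
  shows "m_left_ideal m (down_closure (set_pow UNIV m * {b}))" (is "m_left_ideal m ?L")
proof -
  have L: "x \<in> ?L \<longleftrightarrow> (\<exists>s \<in> set_pow UNIV m. x \<le> s * b)" for x
    by (auto simp: down_closure_def set_times_def)
  have closed: "y * x \<in> ?L" if "x \<in> ?L" for x y
    using that set_pow_UNIV_mult_left semigroup_mult_left_mono
    unfolding L by (metis mult.assoc)
  have "?L \<noteq> {}"
    using set_pow_nonempty[of "UNIV :: 'a set" m] assms L by blast
  with closed show ?thesis
    by (auto simp: m_left_ideal_def subsemigroup_def down_closure_idem elim!: set_times_elim)
qed

lemma m_right_ideal_principal:
  fixes b :: "'a::ordered_semigroup"
  assumes "m \<ge> 1"
  shows "m_right_ideal m (down_closure ({b} * set_pow UNIV m))" (is "m_right_ideal m ?R")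
proof -
  have R: "x \<in> ?R \<longleftrightarrow> (\<exists>s \<in> set_pow UNIV m. x \<le> b * s)" for x
    by (auto simp: down_closure_def set_times_def)
  have closed: "x * y \<in> ?R" if "x \<in> ?R" for x y
    using that set_pow_UNIV_mult_right semigroup_mult_right_mono
    unfolding R by (metis mult.assoc)
  have "?R \<noteq> {}"
    using set_pow_nonempty[of "UNIV :: 'a set" m] assms R by blast
  with closed show ?thesis
    by (auto simp: m_right_ideal_def subsemigroup_def down_closure_idem elim!: set_times_elim)
qed

lemma m_left_simple_below:
  fixes b x :: "'a::ordered_semigroup"
  assumes "m \<ge> 1" "m_left_simple TYPE('a) m"
  obtains s where "s \<in> set_pow UNIV m" "x \<le> s * b"
proof -
  have "x \<in> down_closure (set_pow UNIV m * {b})"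
    using m_left_ideal_principal assms unfolding m_left_simple_def by blast
  then show thesis
    using that by (auto simp: down_closure_def set_times_def)
qed

text \<open>The choice \<open>x = b\<close> is allowed; then \<open>s\<close> acts on
  \<open>b\<close> as a right unit up to the order, \<open>b \<le> b * s\<close>.\<close>

lemma m_right_simple_below:
  fixes b x :: "'a::ordered_semigroup"
  assumes "m \<ge> 1" "m_right_simple TYPE('a) m"
  obtains s where "s \<in> set_pow UNIV m" "x \<le> b * s"
proof -
  have "x \<in> down_closure ({b} * set_pow UNIV m)"
    using m_right_ideal_principal assms unfolding m_right_simple_def by blast
  then show thesis
    using that by (auto simp: down_closure_def set_times_def)
qed

theorem theorem2p4:
  fixes m :: nat
    and B :: "'a::ordered_semigroup set"
  assumes "m \<ge> 1"
    and "m_simple TYPE('a) m"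
    and "m_bi_interior_ideal m B"
  shows "m_bi_ideal m B"
proof -
  let ?P = "set_pow (UNIV :: 'a set) m"
  have left: "m_left_simple TYPE('a) m" and right: "m_right_simple TYPE('a) m"
    using assms(2) by (auto simp: m_simple_def)
  have nonempty: "B \<noteq> {}" and down: "down_closure B = B"
    and inter: "down_closure (B * ?P * B) \<inter> down_closure (?P * B * ?P) \<subseteq> B"
    using assms(3) by (auto simp: m_bi_interior_ideal_def)
  obtain b where b: "b \<in> B"
    using nonempty by blast
  obtain t where t: "t \<in> ?P" "b \<le> b * t"
    using m_right_simple_below[OF assms(1) right] .
  have "x \<in> down_closure (?P * B * ?P)" for x
  proof -
    obtain s where s: "s \<in> ?P" "x \<le> s * b"
      using m_left_simple_below[OF assms(1) left] .
    note s(2)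
    \<comment> \<open>Enlarging \<open>b\<close> to \<open>b * t\<close> supplies the missing right
      factor from S^m.\<close>
    also have "s * b \<le> s * b * t"
      using semigroup_mult_left_mono[OF t(2)] by (simp add: mult.assoc)
    finally show ?thesis
      using s(1) b t(1) by (auto simp: down_closure_def intro!: bexI set_times_intro)
  qed
  with inter have sub: "down_closure (B * ?P * B) \<subseteq> B"
    by blast
  have "a * c \<in> B" if "a \<in> B" "c \<in> B" for a c
  proof -
    \<comment> \<open>The element \<open>u\<close> depends on \<open>a\<close>; it fills the middle
      slot of \<open>B * ?P * B\<close>.\<close>
    obtain u where u: "u \<in> ?P" "a \<le> a * u"
      using m_right_simple_below[OF assms(1) right] .
    have "a * c \<le> a * u * c"
      using u(2) by (rule semigroup_mult_right_mono)
    moreover have "a * u * c \<in> B * ?P * B"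
      using that u(1) by (intro set_times_intro)
    ultimately show ?thesis
      using sub by (auto simp: down_closure_def)
  qed
  then have "B * B \<subseteq> B"
    by (auto elim: set_times_elim)
  moreover have "B * ?P * B \<subseteq> B"
    using sub down_closure_increasing by blast
  ultimately show ?thesis
    using nonempty down by (simp add: m_bi_ideal_def subsemigroup_def)
qed

end
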